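(* Let $A$ be a Banach algebra. Then: (i) If $A^*A=A^*$ and $A$ has the $RW^*W$-property, then $A$ is Arens regular. (ii) If $AA^*=A^*$ and $A$ has the $LW^*W$-property, then $A$ is Arens regular.
   Context: For $a,b\in A$, $f\in A^*$, $F,G\in A^{**}$, the first Arens product is defined by $\langle f.a,b\rangle=\langle f,ab\rangle$, $\langle F.f,a\rangle=\langle F,f.a\rangle$, $\langle F.G,f\rangle=\langle F,G.f\rangle$; the second by $\langle a\circ f,b\rangle=\langle f,ba\rangle$, $\langle f\circ F,a\rangle=\langle F,a\circ f\rangle$, $\langle F\circ G,f\rangle=\langle G,f\circ F\rangle$. Write $a.f=a\circ f$. $A$ is Arens regular if $F.G=F\circ G$ for all $F,G\in A^{**}$. $A^*A=\{f.a: f\in A^*,a\in A\}$ and $AA^*=\{a\circ f: a\in A,f\in A^*\}$. An element $a\in A$ has the $LW^*W$-property if for every net $(f_\alpha)$ in $A^*$, $a.f_\alpha\to0$ weak$^*$ in $A^*$ implies $a.f_\alpha\to 0$ weakly in $A^*$; it has the $RW^*W$-property if for every net $(f_\alpha)$ in $A^*$, $f_\alpha.a\to0$ weak$^*$ implies $f_\alpha.a\to0$ weakly. $A$ has the $LW^*W$-property (resp. $RW^*W$-property) if every $a\in A$ has it. *)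

theory Defs
  imports "HOL-Analysis.Analysis"
begin

text \<open>
  The library has no class of complex Banach algebras, so the scalar field is a type
  \<open>'k :: real_normed_field\<close> acting through an explicit \<open>scl\<close>. By the Gelfand-Mazur theorem the
  instances of this class are, up to isometric isomorphism, exactly the reals and the complex numbers.
  The type class part provides the underlying complete real normed algebra, which need not have a
  unit; \<open>scl_of_real\<close> ties its real scalar multiplication to \<open>scl\<close>.
\<close>

locale banach_algebra = vector_space scl
  for scl :: "'k::real_normed_field \<Rightarrow> 'a::{real_normed_algebra, banach} \<Rightarrow> 'a" +
  assumes scl_of_real: "scl (of_real r) x = r *\<^sub>R x"
    and norm_scl: "norm (scl c x) = norm c * norm x"
    and scl_mult_left: "scl c x * y = scl c (x * y)"
    and scl_mult_right: "x * scl c y = scl c (x * y)"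

lemma banach_algebra_scaleR:
  "banach_algebra (scaleR :: real \<Rightarrow> 'a::{real_normed_algebra, banach} \<Rightarrow> 'a)"
  by unfold_locales (auto simp: algebra_simps)

lemma banach_algebra_complex:
  "banach_algebra ((*) :: complex \<Rightarrow> complex \<Rightarrow> complex)"
  by unfold_locales (auto simp: algebra_simps norm_mult scaleR_conv_of_real)

definition dual_space ::
    "('k::real_normed_field \<Rightarrow> 'a::real_normed_vector \<Rightarrow> 'a) \<Rightarrow> ('a \<Rightarrow> 'k) set" where
  "dual_space scl = {f. bounded_linear f \<and> (\<forall>c x. f (scl c x) = c * f x)}"

text \<open>
  Elements of \<open>A\<^sup>*\<^sup>*\<close> are bounded linear functionals on the subspace \<open>dual_space scl\<close> of
  \<open>'a \<Rightarrow> 'k\<close>, whose norm is \<open>onorm\<close>. They are represented by functions whose values outside that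
  subspace are irrelevant, so two of them are equal if they agree on \<open>dual_space scl\<close>.
\<close>

definition bidual_space ::
    "('k::real_normed_field \<Rightarrow> 'a::real_normed_vector \<Rightarrow> 'a) \<Rightarrow> (('a \<Rightarrow> 'k) \<Rightarrow> 'k) set" where
  "bidual_space scl = {F.
     (\<forall>f\<in>dual_space scl. \<forall>g\<in>dual_space scl. F (\<lambda>x. f x + g x) = F f + F g) \<and>
     (\<forall>c. \<forall>f\<in>dual_space scl. F (\<lambda>x. c * f x) = c * F f) \<and>
     (\<exists>K. \<forall>f\<in>dual_space scl. norm (F f) \<le> K * onorm f)}"

text \<open>First Arens product: \<open>f.a\<close>, \<open>F.f\<close> and \<open>F.G\<close>.\<close>

definition dual_act1 :: "('a::times \<Rightarrow> 'k) \<Rightarrow> 'a \<Rightarrow> ('a \<Rightarrow> 'k)" where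
  "dual_act1 f a = (\<lambda>b. f (a * b))"

definition bidual_act1 :: "(('a::times \<Rightarrow> 'k) \<Rightarrow> 'k) \<Rightarrow> ('a \<Rightarrow> 'k) \<Rightarrow> ('a \<Rightarrow> 'k)" where
  "bidual_act1 F f = (\<lambda>a. F (dual_act1 f a))"

definition arens1 ::
    "(('a::times \<Rightarrow> 'k) \<Rightarrow> 'k) \<Rightarrow> (('a \<Rightarrow> 'k) \<Rightarrow> 'k) \<Rightarrow> (('a \<Rightarrow> 'k) \<Rightarrow> 'k)" where
  "arens1 F G = (\<lambda>f. F (bidual_act1 G f))"

text \<open>Second Arens product: \<open>a \<circ> f\<close> (also written \<open>a.f\<close>), \<open>f \<circ> F\<close> and \<open>F \<circ> G\<close>.\<close>

definition dual_act2 :: "'a::times \<Rightarrow> ('a \<Rightarrow> 'k) \<Rightarrow> ('a \<Rightarrow> 'k)" where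
  "dual_act2 a f = (\<lambda>b. f (b * a))"

definition bidual_act2 :: "('a::times \<Rightarrow> 'k) \<Rightarrow> (('a \<Rightarrow> 'k) \<Rightarrow> 'k) \<Rightarrow> ('a \<Rightarrow> 'k)" where
  "bidual_act2 f F = (\<lambda>a. F (dual_act2 a f))"

definition arens2 ::
    "(('a::times \<Rightarrow> 'k) \<Rightarrow> 'k) \<Rightarrow> (('a \<Rightarrow> 'k) \<Rightarrow> 'k) \<Rightarrow> (('a \<Rightarrow> 'k) \<Rightarrow> 'k)" where
  "arens2 F G = (\<lambda>f. G (bidual_act2 f F))"

definition arens_regular ::
    "('k::real_normed_field \<Rightarrow> 'a::real_normed_algebra \<Rightarrow> 'a) \<Rightarrow> bool" where
  "arens_regular scl \<longleftrightarrow>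
     (\<forall>F\<in>bidual_space scl. \<forall>G\<in>bidual_space scl. \<forall>f\<in>dual_space scl.
        arens1 F G f = arens2 F G f)"

definition dual_A ::
    "('k::real_normed_field \<Rightarrow> 'a::real_normed_algebra \<Rightarrow> 'a) \<Rightarrow> ('a \<Rightarrow> 'k) set" where
  "dual_A scl = {dual_act1 f a | f a. f \<in> dual_space scl}"

definition A_dual ::
    "('k::real_normed_field \<Rightarrow> 'a::real_normed_algebra \<Rightarrow> 'a) \<Rightarrow> ('a \<Rightarrow> 'k) set" where
  "A_dual scl = {dual_act2 a f | a f. f \<in> dual_space scl}"

definition weak_star_null :: "('i \<Rightarrow> 'a \<Rightarrow> 'k::real_normed_field) \<Rightarrow> 'i filter \<Rightarrow> bool" where
  "weak_star_null h \<Phi> \<longleftrightarrow> (\<forall>x. ((\<lambda>i. h i x) \<longlongrightarrow> 0) \<Phi>)"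

definition weak_null ::
    "('k::real_normed_field \<Rightarrow> 'a::real_normed_vector \<Rightarrow> 'a) \<Rightarrow> ('i \<Rightarrow> 'a \<Rightarrow> 'k) \<Rightarrow> 'i filter \<Rightarrow> bool" where
  "weak_null scl h \<Phi> \<longleftrightarrow> (\<forall>F\<in>bidual_space scl. ((\<lambda>i. F (h i)) \<longlongrightarrow> 0) \<Phi>)"

text \<open>
  Nets in \<open>A\<^sup>*\<close> are rendered as filters on \<open>A\<^sup>*\<close>: a net gives its filter of tails, every proper filter
  arises in this way, and convergence only depends on it. This is no restriction to nets with
  particular index types, by the lemmas \<open>LWW_elem_net\<close> and \<open>RWW_elem_net\<close> below.
\<close>

definition LWW_elem ::
    "('k::real_normed_field \<Rightarrow> 'a::real_normed_algebra \<Rightarrow> 'a) \<Rightarrow> 'a \<Rightarrow> bool" where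
  "LWW_elem scl a \<longleftrightarrow>
     (\<forall>\<Phi>. (\<forall>\<^sub>F f in \<Phi>. f \<in> dual_space scl) \<longrightarrow>
        weak_star_null (\<lambda>f. dual_act2 a f) \<Phi> \<longrightarrow> weak_null scl (\<lambda>f. dual_act2 a f) \<Phi>)"

definition RWW_elem ::
    "('k::real_normed_field \<Rightarrow> 'a::real_normed_algebra \<Rightarrow> 'a) \<Rightarrow> 'a \<Rightarrow> bool" where
  "RWW_elem scl a \<longleftrightarrow>
     (\<forall>\<Phi>. (\<forall>\<^sub>F f in \<Phi>. f \<in> dual_space scl) \<longrightarrow>
        weak_star_null (\<lambda>f. dual_act1 f a) \<Phi> \<longrightarrow> weak_null scl (\<lambda>f. dual_act1 f a) \<Phi>)"

lemma LWW_elem_net: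
  assumes "LWW_elem scl a" "\<And>i. f i \<in> dual_space scl"
    and "weak_star_null (\<lambda>i. dual_act2 a (f i)) \<Phi>"
  shows "weak_null scl (\<lambda>i. dual_act2 a (f i)) \<Phi>"
  using assms(1)[unfolded LWW_elem_def, rule_format, of "filtermap f \<Phi>"] assms(2,3)
  by (simp add: weak_star_null_def weak_null_def filterlim_filtermap eventually_filtermap)

lemma RWW_elem_net:
  assumes "RWW_elem scl a" "\<And>i. f i \<in> dual_space scl"
    and "weak_star_null (\<lambda>i. dual_act1 (f i) a) \<Phi>"
  shows "weak_null scl (\<lambda>i. dual_act1 (f i) a) \<Phi>"
  using assms(1)[unfolded RWW_elem_def, rule_format, of "filtermap f \<Phi>"] assms(2,3)
  by (simp add: weak_star_null_def weak_null_def filterlim_filtermap eventually_filtermap)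

definition LWW_property ::
    "('k::real_normed_field \<Rightarrow> 'a::real_normed_algebra \<Rightarrow> 'a) \<Rightarrow> bool" where
  "LWW_property scl \<longleftrightarrow> (\<forall>a. LWW_elem scl a)"

definition RWW_property ::
    "('k::real_normed_field \<Rightarrow> 'a::real_normed_algebra \<Rightarrow> 'a) \<Rightarrow> bool" where
  "RWW_property scl \<longleftrightarrow> (\<forall>a. RWW_elem scl a)"

end

theory Submission
  imports Defs
begin

text \<open>
  Every \<open>G \<in> A\<^sup>*\<^sup>*\<close> is the weak\<open>\<^sup>*\<close> limit of some net \<open>(a\<^sub>\<alpha>)\<close> in \<open>A\<close>. If \<open>f = g.c\<close>, then
  \<open>G.f - a\<^sub>\<alpha> \<circ> f = (G.g - a\<^sub>\<alpha> \<circ> g).c\<close> tends to \<open>0\<close> weak\<open>\<^sup>*\<close>, so the \<open>RW\<^sup>*W\<close>-property makes it tend to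
  \<open>0\<close> weakly. Applying \<open>F\<close> gives \<open>(f \<circ> F)(a\<^sub>\<alpha>) = F(a\<^sub>\<alpha> \<circ> f) \<longrightarrow> F(G.f)\<close>, whereas
  \<open>(f \<circ> F)(a\<^sub>\<alpha>) \<longrightarrow> G(f \<circ> F)\<close>. The second part is the mirror image, with \<open>a\<^sub>\<alpha> \<longrightarrow> F\<close>.
\<close>

section \<open>The dual space and the two module actions on it\<close>

lemma dual_spaceI:
  fixes scl :: "'k::real_normed_field \<Rightarrow> 'a::{real_normed_algebra, banach} \<Rightarrow> 'a"
  assumes "banach_algebra scl"
    and add: "\<And>x y. f (x + y) = f x + f y"
    and scale: "\<And>c x. f (scl c x) = c * f x"
    and bound: "\<And>x. norm (f x) \<le> norm x * K"
  shows "f \<in> dual_space scl"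
proof -
  interpret banach_algebra scl by fact
  \<comment> \<open>Real scalars act through \<open>of_real\<close>, so homogeneity for
    \<open>scl\<close> contains the real homogeneity demanded by
    \<open>bounded_linear\<close>.\<close>
  have "f (r *\<^sub>R x) = r *\<^sub>R f x" for r x
    using scale[of "of_real r" x] by (simp add: scl_of_real scaleR_conv_of_real)
  then have "bounded_linear f"
    using add bound by (intro bounded_linear_intro)
  then show ?thesis
    using scale by (simp add: dual_space_def)
qed

lemma dual_spaceD:
  assumes "f \<in> dual_space scl"
  shows "bounded_linear f" "f (scl c x) = c * f x" "f (x + y) = f x + f y" "f (x - y) = f x - f y"
    "norm (f x) \<le> onorm f * norm x"
  using assms
  by (simp_all add: dual_space_def onorm bounded_linear.linear linear_add linear_diff)

lemma dual_space_diff_scale: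
  assumes "banach_algebra scl" "f \<in> dual_space scl" "g \<in> dual_space scl"
  shows "(\<lambda>x. f x - c * g x) \<in> dual_space scl"
proof (rule dual_spaceI[OF assms(1), where K = "onorm f + norm c * onorm g"])
  fix x
  have "norm (f x - c * g x) \<le> norm (f x) + norm c * norm (g x)"
    by (metis norm_triangle_ineq4 norm_mult)
  also have "\<dots> \<le> onorm f * norm x + norm c * (onorm g * norm x)"
    using assms(2,3) by (intro add_mono mult_left_mono dual_spaceD(5)) auto
  finally show "norm (f x - c * g x) \<le> norm x * (onorm f + norm c * onorm g)"
    by (simp add: algebra_simps)
qed (use assms(2,3) in \<open>auto simp: dual_spaceD algebra_simps\<close>)

lemma dual_space_diff:
  assumes "banach_algebra scl" "f \<in> dual_space scl" "g \<in> dual_space scl"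
  shows "(\<lambda>x. f x - g x) \<in> dual_space scl"
  using dual_space_diff_scale[OF assms, of 1] by simp

text \<open>The \<open>onorm\<close> estimates are what later makes \<open>bidual_act1 F f\<close>
  and \<open>bidual_act2 f F\<close> bounded in the algebra variable.\<close>

lemma dual_act_in_dual_space:
  assumes "banach_algebra scl" "f \<in> dual_space scl"
  shows "dual_act1 f a \<in> dual_space scl" "dual_act2 a f \<in> dual_space scl"
    and "onorm (dual_act1 f a) \<le> onorm f * norm a" "onorm (dual_act2 a f) \<le> onorm f * norm a"
proof -
  interpret banach_algebra scl by fact
  have pos: "0 \<le> onorm f"
    using assms(2) by (intro onorm_pos_le dual_spaceD(1))
  have n1: "norm (dual_act1 f a x) \<le> (onorm f * norm a) * norm x" for x
  proof -
    have "norm (dual_act1 f a x) \<le> onorm f * norm (a * x)"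
      unfolding dual_act1_def using assms(2) by (rule dual_spaceD)
    also have "\<dots> \<le> onorm f * (norm a * norm x)"
      using pos by (intro mult_left_mono norm_mult_ineq)
    finally show ?thesis by (simp add: mult.assoc)
  qed
  have n2: "norm (dual_act2 a f x) \<le> (onorm f * norm a) * norm x" for x
  proof -
    have "norm (dual_act2 a f x) \<le> onorm f * norm (x * a)"
      unfolding dual_act2_def using assms(2) by (rule dual_spaceD)
    also have "\<dots> \<le> onorm f * (norm x * norm a)"
      using pos by (intro mult_left_mono norm_mult_ineq)
    finally show ?thesis by (simp add: mult_ac)
  qed
  show "dual_act1 f a \<in> dual_space scl"
    using n1 by (intro dual_spaceI[OF assms(1), where K = "onorm f * norm a"])
      (auto simp: dual_act1_def distrib_left scl_mult_right dual_spaceD[OF assms(2)] mult_ac)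
  show "dual_act2 a f \<in> dual_space scl"
    using n2 by (intro dual_spaceI[OF assms(1), where K = "onorm f * norm a"])
      (auto simp: dual_act2_def distrib_right scl_mult_left dual_spaceD[OF assms(2)] mult_ac)
  show "onorm (dual_act1 f a) \<le> onorm f * norm a" "onorm (dual_act2 a f) \<le> onorm f * norm a"
    using n1 n2 pos by (auto intro!: onorm_bound)
qed

section \<open>The bidual and its actions on the dual\<close>

lemma bidual_spaceD:
  assumes "F \<in> bidual_space scl" "f \<in> dual_space scl"
  shows "g \<in> dual_space scl \<Longrightarrow> F (\<lambda>x. f x + g x) = F f + F g" "F (\<lambda>x. c * f x) = c * F f"
  using assms by (auto simp: bidual_space_def)

lemma bidual_space_bound:
  assumes "F \<in> bidual_space scl"
  obtains K where "0 \<le> K" "\<And>f. f \<in> dual_space scl \<Longrightarrow> norm (F f) \<le> K * onorm f"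
proof -
  obtain K where K: "\<forall>f\<in>dual_space scl. norm (F f) \<le> K * onorm f"
    using assms by (auto simp: bidual_space_def)
  \<comment> \<open>The constant from \<open>bidual_space\<close> may be negative, for instance when
    the dual is zero; its absolute value still bounds \<open>F\<close>.\<close>
  have "norm (F f) \<le> \<bar>K\<bar> * onorm f" if "f \<in> dual_space scl" for f
  proof -
    have "0 \<le> onorm f" using that by (intro onorm_pos_le dual_spaceD(1))
    then have "K * onorm f \<le> \<bar>K\<bar> * onorm f" by (intro mult_right_mono) auto
    then show ?thesis using K that by fastforce
  qed
  then show ?thesis using that[of "\<bar>K\<bar>"] by simp
qed

lemma bidual_diff_scale:
  assumes "banach_algebra scl" "F \<in> bidual_space scl" "f \<in> dual_space scl" "g \<in> dual_space scl"
  shows "F (\<lambda>x. f x - c * g x) = F f - c * F g"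
proof -
  have "F f = F (\<lambda>x. (f x - c * g x) + c * g x)" by simp
  also have "\<dots> = F (\<lambda>x. f x - c * g x) + F (\<lambda>x. c * g x)"
    \<comment> \<open>Since g - (1 - c) g = c g, this instance puts c g into the dual, where
      \<open>F\<close> is known to be additive.\<close>
    using dual_space_diff_scale[OF assms(1,4,4), of "1 - c"]
    by (intro bidual_spaceD(1)[OF assms(2)] dual_space_diff_scale assms) (simp add: algebra_simps)
  finally show ?thesis
    using bidual_spaceD(2)[OF assms(2,4)] by (simp add: algebra_simps)
qed

lemma bidual_diff:
  assumes "banach_algebra scl" "F \<in> bidual_space scl" "f \<in> dual_space scl" "g \<in> dual_space scl"
  shows "F (\<lambda>x. f x - g x) = F f - F g"
  using bidual_diff_scale[OF assms, of 1] by simp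

lemma bidual_act_in_dual_space:
  assumes ba: "banach_algebra scl" and F: "F \<in> bidual_space scl" and f: "f \<in> dual_space scl"
  shows "bidual_act1 F f \<in> dual_space scl" "bidual_act2 f F \<in> dual_space scl"
proof -
  interpret banach_algebra scl by fact
  note act = dual_act_in_dual_space[OF ba f]
  obtain K where K: "0 \<le> K" "\<And>f. f \<in> dual_space scl \<Longrightarrow> norm (F f) \<le> K * onorm f"
    using bidual_space_bound[OF F] by blast
  have bound: "norm (F h) \<le> norm a * (K * onorm f)"
    if "h \<in> dual_space scl" "onorm h \<le> onorm f * norm a" for h a
    using K(2)[OF that(1)] mult_left_mono[OF that(2) K(1)] by (simp add: mult_ac)
  have add: "dual_act1 f (a + b) = (\<lambda>x. dual_act1 f a x + dual_act1 f b x)"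
    "dual_act2 (a + b) f = (\<lambda>x. dual_act2 a f x + dual_act2 b f x)" for a b
    by (auto simp: dual_act1_def dual_act2_def distrib_left distrib_right dual_spaceD(3)[OF f])
  have scale: "dual_act1 f (scl c a) = (\<lambda>x. c * dual_act1 f a x)"
    "dual_act2 (scl c a) f = (\<lambda>x. c * dual_act2 a f x)" for a c
    by (auto simp: dual_act1_def dual_act2_def scl_mult_left scl_mult_right dual_spaceD(2)[OF f])
  show "bidual_act1 F f \<in> dual_space scl"
    unfolding bidual_act1_def
    by (rule dual_spaceI[OF ba, where K = "K * onorm f"])
      (simp_all only: add scale bidual_spaceD[OF F act(1)] act(1) bound[OF act(1) act(3)])
  show "bidual_act2 f F \<in> dual_space scl"
    unfolding bidual_act2_def
    by (rule dual_spaceI[OF ba, where K = "K * onorm f"])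
      (simp_all only: add scale bidual_spaceD[OF F act(2)] act(2) bound[OF act(2) act(4)])
qed

section \<open>Weak-star approximation of bidual elements by points of the algebra\<close>

text \<open>
  This replaces the statement that a functional vanishing on \<open>\<Inter>\<^sub>s ker s\<close> is a linear combination
  of the \<open>s \<in> S\<close>.
\<close>

lemma functional_eq_of_common_kernel:
  assumes ba: "banach_algebra scl" and F: "F \<in> bidual_space scl"
    and "finite S" "S \<subseteq> dual_space scl" "f \<in> dual_space scl"
    and "\<And>s. s \<in> S \<Longrightarrow> F s = s a"
    and "\<And>y. (\<And>s. s \<in> S \<Longrightarrow> s y = 0) \<Longrightarrow> f y = 0"
  shows "F f = f a"
  using assms(3-)
proof (induction S arbitrary: f rule: finite_induct)
  case empty
  \<comment> \<open>With no constraints left, \<open>f\<close> is the zero functional; writing it as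
    f - f makes linearity give F f = 0.\<close>
  have "f = (\<lambda>x. f x - 1 * f x)" using empty by auto
  then have "F f = F f - 1 * F f"
    using bidual_diff_scale[OF ba F empty(2,2)] by metis
  then have "F f = 0" by simp
  moreover have "f a = 0" using empty by simp
  ultimately show ?case by simp
next
  case (insert s S)
  have s: "s \<in> dual_space scl" using insert by auto
  note lin_f = dual_spaceD[OF \<open>f \<in> dual_space scl\<close>]
  show ?case
  \<comment> \<open>If no such \<open>x\<close> exists, \<open>s\<close> already vanishes on the
    common kernel of \<open>S\<close>, and the induction hypothesis applies to \<open>f\<close>
    itself.\<close>
  proof (cases "\<exists>x. (\<forall>t\<in>S. t x = 0) \<and> s x \<noteq> 0")
    case False
    show ?thesis
    proof (rule insert.IH)
      fix y assume "\<And>t. t \<in> S \<Longrightarrow> t y = 0"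
      then show "f y = 0" using False insert.prems(4) by blast
    qed (use insert.prems(1-3) in blast)+
  next
    case True
    then obtain x where x: "\<And>t. t \<in> S \<Longrightarrow> t x = 0" "s x \<noteq> 0" by blast
    \<comment> \<open>This choice makes f - c s vanish at \<open>x\<close>, so that it vanishes on
      the whole common kernel of \<open>S\<close>.\<close>
    define c where "c = f x / s x"
    have "F (\<lambda>y. f y - c * s y) = f a - c * s a"
    proof (rule insert.IH)
      fix y assume y: "\<And>t. t \<in> S \<Longrightarrow> t y = 0"
      \<comment> \<open>Projection of \<open>y\<close> along \<open>x\<close> onto the kernel of
        \<open>s\<close>; it stays in the kernel of \<open>S\<close> because \<open>x\<close> lies
        there, and f z = f y - c s y.\<close>
      define z where "z = y - scl (s y / s x) x"
      have "t z = 0" if "t \<in> insert s S" for t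
      proof -
        have t: "t \<in> dual_space scl" using that insert.prems(1) by blast
        have "t z = t y - s y / s x * t x"
          by (simp add: z_def dual_spaceD(2,4)[OF t])
        moreover have "t = s \<or> t x = 0 \<and> t y = 0" using that x(1) y by blast
        ultimately show ?thesis using x(2) by auto
      qed
      then have "f z = 0" using insert.prems by blast
      then show "f y - c * s y = 0"
        using x(2) by (simp add: z_def c_def lin_f(2,4))
    next
      show "(\<lambda>y. f y - c * s y) \<in> dual_space scl"
        using insert.prems(2) s by (rule dual_space_diff_scale[OF ba])
    qed (use insert.prems(1,3) in blast)+
    moreover have "F s = s a" using insert.prems(3) by blast
    ultimately show ?thesis
      using bidual_diff_scale[OF ba F insert.prems(2) s, of c] by simp
  qed
qed

text \<open>Finite interpolation in the manner of Helly, without control of the norm of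
  \<open>a\<close>: each new functional is either determined by the earlier ones or can be adjusted
  in a direction they do not see.\<close>

lemma bidual_eval_finite:
  assumes ba: "banach_algebra scl" and F: "F \<in> bidual_space scl"
    and "finite S" "S \<subseteq> dual_space scl"
  shows "\<exists>a. \<forall>f\<in>S. f a = F f"
  using assms(3-)
proof (induction S rule: finite_induct)
  case (insert f S)
  then obtain a where a: "\<And>s. s \<in> S \<Longrightarrow> s a = F s" by auto
  have f: "f \<in> dual_space scl" using insert by auto
  show ?case
  proof (cases "\<exists>x. (\<forall>s\<in>S. s x = 0) \<and> f x \<noteq> 0")
    case False
    have "F f = f a"
    proof (rule functional_eq_of_common_kernel[OF ba F insert.hyps(1) _ f])
      show "S \<subseteq> dual_space scl" using insert.prems by blast
      show "F s = s a" if "s \<in> S" for s using a[OF that] by (rule sym)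
      show "f y = 0" if "\<And>s. s \<in> S \<Longrightarrow> s y = 0" for y using False that by blast
    qed
    then show ?thesis using a by (metis insert_iff)
  next
    case True
    then obtain x where x: "\<And>t. t \<in> S \<Longrightarrow> t x = 0" "f x \<noteq> 0" by blast
    \<comment> \<open>The multiple of \<open>x\<close> corrects the value of \<open>f\<close> and
      leaves the values of all members of \<open>S\<close> unchanged.\<close>
    let ?b = "a + scl ((F f - f a) / f x) x"
    have "s ?b = F s" if "s \<in> S" for s
    proof -
      have "s \<in> dual_space scl" using that insert.prems by blast
      then show ?thesis by (simp add: dual_spaceD(2,3) x(1)[OF that] a[OF that])
    qed
    moreover have "f ?b = F f"
      using x(2) by (simp add: dual_spaceD(2,3)[OF f])
    ultimately show ?thesis by blast
  qed
qed auto

text \<open>Finite interpolation gives the sets {a. f a = F f} the finite intersection property, so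
  they generate a proper filter. Along it each f a is even eventually equal to F f. The filter need
  not be bounded, which is harmless because the properties applied below allow arbitrary
  filters.\<close>

lemma weak_star_dense:
  assumes ba: "banach_algebra scl" and F: "F \<in> bidual_space scl"
  obtains \<Phi> where "\<Phi> \<noteq> bot" "\<And>f. f \<in> dual_space scl \<Longrightarrow> ((\<lambda>a. f a) \<longlongrightarrow> F f) \<Phi>"
proof
  let ?\<Phi> = "INF f\<in>dual_space scl. principal {a. f a = F f}"
  show "?\<Phi> \<noteq> bot"
  proof (rule INF_filter_not_bot)
    fix S assume S: "S \<subseteq> dual_space scl" "finite S"
    then obtain a where "\<forall>f\<in>S. f a = F f"
      using bidual_eval_finite[OF ba F] by blast
    then show "(INF f\<in>S. principal {a. f a = F f}) \<noteq> bot"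
      by (auto simp: INF_principal_finite[OF S(2)] principal_eq_bot_iff)
  qed
  fix f assume "f \<in> dual_space scl"
  then have "eventually (\<lambda>a. f a = F f) ?\<Phi>"
    by (auto intro!: eventually_INF1 simp: eventually_principal)
  then show "((\<lambda>a. f a) \<longlongrightarrow> F f) ?\<Phi>"
    by (rule tendsto_eventually)
qed

section \<open>Comparison of the two Arens products on a factored functional\<close>

lemma arens_eq_of_RWW_elem:
  assumes ba: "banach_algebra scl" and F: "F \<in> bidual_space scl" and G: "G \<in> bidual_space scl"
    and g: "g \<in> dual_space scl" and R: "RWW_elem scl c"
  shows "arens1 F G (dual_act1 g c) = arens2 F G (dual_act1 g c)"
proof -
  let ?f = "dual_act1 g c"
  note f = dual_act_in_dual_space(1)[OF ba g, of c]
  obtain \<Phi> where \<Phi>: "\<Phi> \<noteq> bot" "\<And>f. f \<in> dual_space scl \<Longrightarrow> ((\<lambda>a. f a) \<longlongrightarrow> G f) \<Phi>"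
    using weak_star_dense[OF ba G] by blast
  \<comment> \<open>The difference is formed with \<open>g\<close>, before acting by
    \<open>c\<close>, because the property of \<open>c\<close> concerns nets of the form
    \<open>dual_act1 (h a) c\<close>.\<close>
  define h where "h a = (\<lambda>b. bidual_act1 G g b - dual_act2 a g b)" for a
  have h_dual: "h a \<in> dual_space scl" for a
    unfolding h_def using ba G g
    by (intro dual_space_diff bidual_act_in_dual_space dual_act_in_dual_space)
  \<comment> \<open>Associativity lets the right action of \<open>c\<close> pass through both G.g
    and a \<circ> g.\<close>
  have h: "dual_act1 (h a) c = (\<lambda>b. bidual_act1 G ?f b - dual_act2 a ?f b)" for a
    by (auto simp: h_def bidual_act1_def dual_act1_def dual_act2_def mult.assoc)
  \<comment> \<open>At a fixed \<open>b\<close>, (a \<circ> f)(b) = f(ba) = (f.b)(a), and f.b lies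
    in the dual, so the limit along \<Phi> is G(f.b) = (G.f)(b).\<close>
  have "((\<lambda>a. dual_act1 (h a) c b) \<longlongrightarrow> G (dual_act1 ?f b) - G (dual_act1 ?f b)) \<Phi>" for b
    using tendsto_diff[OF tendsto_const[of "G (dual_act1 ?f b)"]
        \<Phi>(2)[OF dual_act_in_dual_space(1)[OF ba f, of b]]]
    unfolding h by (simp add: bidual_act1_def dual_act1_def dual_act2_def)
  then have "weak_star_null (\<lambda>a. dual_act1 (h a) c) \<Phi>"
    by (simp add: weak_star_null_def)
  then have "weak_null scl (\<lambda>a. dual_act1 (h a) c) \<Phi>"
    using R h_dual by (intro RWW_elem_net)
  then have "((\<lambda>a. F (dual_act1 (h a) c)) \<longlongrightarrow> 0) \<Phi>"
    using F by (simp add: weak_null_def)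
  moreover have "F (dual_act1 (h a) c) = F (bidual_act1 G ?f) - bidual_act2 ?f F a" for a
    unfolding h using ba F G f
    by (subst bidual_diff[OF ba F])
      (auto simp: bidual_act2_def intro: bidual_act_in_dual_space dual_act_in_dual_space)
  ultimately have "((\<lambda>a. F (bidual_act1 G ?f) - bidual_act2 ?f F a) \<longlongrightarrow> 0) \<Phi>"
    by simp
  moreover have "((\<lambda>a. F (bidual_act1 G ?f) - bidual_act2 ?f F a)
      \<longlongrightarrow> F (bidual_act1 G ?f) - G (bidual_act2 ?f F)) \<Phi>"
    by (intro tendsto_diff tendsto_const \<Phi>(2) bidual_act_in_dual_space ba F f)
  ultimately have "0 = F (bidual_act1 G ?f) - G (bidual_act2 ?f F)"
    by (rule tendsto_unique[OF \<Phi>(1)])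
  then show ?thesis
    by (simp add: arens1_def arens2_def)
qed

lemma arens_eq_of_LWW_elem:
  assumes ba: "banach_algebra scl" and F: "F \<in> bidual_space scl" and G: "G \<in> bidual_space scl"
    and g: "g \<in> dual_space scl" and L: "LWW_elem scl c"
  shows "arens1 F G (dual_act2 c g) = arens2 F G (dual_act2 c g)"
proof -
  let ?f = "dual_act2 c g"
  note f = dual_act_in_dual_space(2)[OF ba g, of c]
  obtain \<Phi> where \<Phi>: "\<Phi> \<noteq> bot" "\<And>f. f \<in> dual_space scl \<Longrightarrow> ((\<lambda>a. f a) \<longlongrightarrow> F f) \<Phi>"
    using weak_star_dense[OF ba F] by blast
  \<comment> \<open>Here f = c \<circ> g, and acting by \<open>c\<close> on g \<circ> F - g.a yields
    f \<circ> F - f.a; applying \<open>G\<close> to f.a then gives (G.f)(a), which tends to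
    F(G.f).\<close>
  define h where "h a = (\<lambda>b. bidual_act2 g F b - dual_act1 g a b)" for a
  have h_dual: "h a \<in> dual_space scl" for a
    unfolding h_def using ba F g
    by (intro dual_space_diff bidual_act_in_dual_space dual_act_in_dual_space)
  have h: "dual_act2 c (h a) = (\<lambda>b. bidual_act2 ?f F b - dual_act1 ?f a b)" for a
    by (auto simp: h_def bidual_act2_def dual_act1_def dual_act2_def mult.assoc)
  have "((\<lambda>a. dual_act2 c (h a) b) \<longlongrightarrow> F (dual_act2 b ?f) - F (dual_act2 b ?f)) \<Phi>" for b
    using tendsto_diff[OF tendsto_const[of "F (dual_act2 b ?f)"]
        \<Phi>(2)[OF dual_act_in_dual_space(2)[OF ba f, of b]]]
    unfolding h by (simp add: bidual_act2_def dual_act1_def dual_act2_def)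
  then have "weak_star_null (\<lambda>a. dual_act2 c (h a)) \<Phi>"
    by (simp add: weak_star_null_def)
  then have "weak_null scl (\<lambda>a. dual_act2 c (h a)) \<Phi>"
    using L h_dual by (intro LWW_elem_net)
  then have "((\<lambda>a. G (dual_act2 c (h a))) \<longlongrightarrow> 0) \<Phi>"
    using G by (simp add: weak_null_def)
  moreover have "G (dual_act2 c (h a)) = G (bidual_act2 ?f F) - bidual_act1 G ?f a" for a
    unfolding h using ba F G f
    by (subst bidual_diff[OF ba G])
      (auto simp: bidual_act1_def intro: bidual_act_in_dual_space dual_act_in_dual_space)
  ultimately have "((\<lambda>a. G (bidual_act2 ?f F) - bidual_act1 G ?f a) \<longlongrightarrow> 0) \<Phi>"
    by simp
  moreover have "((\<lambda>a. G (bidual_act2 ?f F) - bidual_act1 G ?f a)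
      \<longlongrightarrow> G (bidual_act2 ?f F) - F (bidual_act1 G ?f)) \<Phi>"
    by (intro tendsto_diff tendsto_const \<Phi>(2) bidual_act_in_dual_space ba G f)
  ultimately have "0 = G (bidual_act2 ?f F) - F (bidual_act1 G ?f)"
    by (rule tendsto_unique[OF \<Phi>(1)])
  then show ?thesis
    by (simp add: arens1_def arens2_def)
qed

theorem theorem12:
  fixes scl :: "'k::real_normed_field \<Rightarrow> 'a::{real_normed_algebra, banach} \<Rightarrow> 'a"
  assumes "banach_algebra scl"
  shows "(dual_A scl = dual_space scl \<and> RWW_property scl \<longrightarrow> arens_regular scl) \<and>
         (A_dual scl = dual_space scl \<and> LWW_property scl \<longrightarrow> arens_regular scl)"
proof (intro conjI impI)
  assume *: "dual_A scl = dual_space scl \<and> RWW_property scl"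
  show "arens_regular scl"
    unfolding arens_regular_def
  proof (intro ballI)
    fix F G f
    assume F: "F \<in> bidual_space scl" and G: "G \<in> bidual_space scl" and "f \<in> dual_space scl"
    then have "f \<in> dual_A scl" using * by simp
    then obtain g c where g: "g \<in> dual_space scl" and f: "f = dual_act1 g c"
      unfolding dual_A_def by blast
    have "RWW_elem scl c" using * by (simp add: RWW_property_def)
    then show "arens1 F G f = arens2 F G f"
      unfolding f by (rule arens_eq_of_RWW_elem[OF assms F G g])
  qed
next
  assume *: "A_dual scl = dual_space scl \<and> LWW_property scl"
  show "arens_regular scl"
    unfolding arens_regular_def
  proof (intro ballI)
    fix F G f
    assume F: "F \<in> bidual_space scl" and G: "G \<in> bidual_space scl" and "f \<in> dual_space scl"
    then have "f \<in> A_dual scl" using * by simp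
    then obtain g c where g: "g \<in> dual_space scl" and f: "f = dual_act2 c g"
      unfolding A_dual_def by blast
    have "LWW_elem scl c" using * by (simp add: LWW_property_def)
    then show "arens1 F G f = arens2 F G f"
      unfolding f by (rule arens_eq_of_LWW_elem[OF assms F G g])
  qed
qed

end
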